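(* For real numbers $a<b$, $m$ and $s$ write $$g(a,b;m,s)=\frac{ab-s+\sqrt{(s-ab)^2-(a+b-2m)\left(2abm-(a+b)s\right)}}{a+b-2m}\quad\text{if } a+b\ne 2m,$$ and $g(a,b;m,s)=\frac{a+b}{2}$ if $a+b=2m$. (a) Let $a<b$ be real numbers and let $\theta\in(a,b)$ be a random variable with (posterior) probability density function $f$ and $\mathbb{E}(\theta^2)<\infty$, where $\mathbb{E}$ denotes expectation with respect to $f$. Then the expected loss $\mathbb{E}(L_{iq}(\theta,d))$, as a function of $d\in(a,b)$, where $$L_{iq}(\theta,d)=\frac{(d-\theta)^2}{(d-a)(b-d)},$$ is minimized by $\hat d_{iq}=g(a,b;\mathbb{E}(\theta),\mathbb{E}(\theta^2))$. (b) Let $\theta$ be a random variable with probability density function $f$ and $\mathbb{E}(\theta^2)<\infty$, and keep $\mathbb{E}(\theta)$ and $\mathbb{E}(\theta^2)$ fixed. In the limiting case $a\to-\infty$ and $b\to+\infty$, the limit of $g(a,b;\mathbb{E}(\theta),\mathbb{E}(\theta^2))$ minimizes the expected squared loss $\mathbb{E}\left((\theta-d)^2\right)$ over $d\in\mathbb{R}$. If $\theta$ is positive, then in the limiting case $a\to 0$ and $b\to+\infty$, the limit of $g(a,b;\mathbb{E}(\theta),\mathbb{E}(\theta^2))$ minimizes the expected precautionary loss $\mathbb{E}\left(\frac{(d-\theta)^2}{d}\right)$ over $d\in(0,+\infty)$.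
   Context: A loss function $L(\theta,d)$ assigns a penalty to the decision $d$ when the parameter equals $\theta$. The Bayes estimator associated with $L$ is the decision $d$ minimizing the expected loss $\mathbb{E}(L(\theta,d))$ over the posterior distribution of $\theta$. $L_{iq}$ is called the interval symmetric (interval squared) loss function. *)

theory Defs
  imports "HOL-Probability.Probability"
begin

definition iq_estimate :: "real \<Rightarrow> real \<Rightarrow> real \<Rightarrow> real \<Rightarrow> real" where
  "iq_estimate a b m s =
     (if a + b = 2 * m then (a + b) / 2
      else (a * b - s + sqrt ((s - a * b)\<^sup>2 - (a + b - 2 * m) * (2 * a * b * m - (a + b) * s)))
           / (a + b - 2 * m))"

definition interval_squared_loss :: "real \<Rightarrow> real \<Rightarrow> real \<Rightarrow> real \<Rightarrow> real" where
  "interval_squared_loss a b \<theta> d = (d - \<theta>)\<^sup>2 / ((d - a) * (b - d))"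

definition squared_loss :: "real \<Rightarrow> real \<Rightarrow> real" where
  "squared_loss \<theta> d = (\<theta> - d)\<^sup>2"

definition precautionary_loss :: "real \<Rightarrow> real \<Rightarrow> real" where
  "precautionary_loss \<theta> d = (d - \<theta>)\<^sup>2 / d"

text \<open>
  The Bochner integral is 0 for non-integrable functions. For the three losses above this
  convention plays no role when \<open>\<theta>\<close> has a finite second moment: each loss is, for fixed \<open>d\<close>,
  a polynomial of degree 2 in \<open>\<theta>\<close>, hence integrable.
\<close>

definition expected_loss ::
  "'a measure \<Rightarrow> ('a \<Rightarrow> real) \<Rightarrow> (real \<Rightarrow> real \<Rightarrow> real) \<Rightarrow> real \<Rightarrow> real" where
  "expected_loss M \<theta> L d = (\<integral>\<omega>. L (\<theta> \<omega>) d \<partial>M)"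

text \<open>
  \<open>d\<close> minimizes the expected loss over the decision set \<open>D\<close>; this includes \<open>d \<in> D\<close>.
\<close>

definition minimizes_expected_loss ::
  "'a measure \<Rightarrow> ('a \<Rightarrow> real) \<Rightarrow> (real \<Rightarrow> real \<Rightarrow> real) \<Rightarrow> real set \<Rightarrow> real \<Rightarrow> bool" where
  "minimizes_expected_loss M \<theta> L D d \<longleftrightarrow> is_arg_min (expected_loss M \<theta> L) (\<lambda>d. d \<in> D) d"

end

theory Submission
  imports Defs
begin

text \<open>
  Only the first two moments \<open>m\<close> and \<open>s\<close> of \<open>\<theta>\<close> matter, because the posterior expectation of
  \<open>(d - \<theta>)\<^sup>2\<close> is the quadratic \<open>N d = d\<^sup>2 - 2 d m + s\<close>. All three risks are \<open>N d\<close> divided by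
  a deterministic weight: \<open>Q d = (d - a) (b - d)\<close>, \<open>1\<close> and \<open>d\<close> respectively.

  For the interval loss, the numerator \<open>N' Q - N Q'\<close> of the derivative of \<open>N / Q\<close> is at most
  quadratic, since the cubic terms cancel; with \<open>p = a + b - 2 m\<close>, \<open>u = s - a b\<close> and
  \<open>q = 2 a b m - (a + b) s\<close> it equals \<open>p d\<^sup>2 + 2 u d + q\<close>. It is negative at \<open>a\<close> and positive at
  \<open>b\<close>, so it has exactly one root in between, at which it increases. This selects the sign of the
  square root in the quadratic formula (lemma \<open>increasing_quadratic_root_between\<close>), and the
  formula is the estimate (lemma \<open>iq_estimate_critical\<close>). Optimality of a critical point needs no
  calculus: \<open>N d * Q g - N g * Q d\<close> is a quadratic in \<open>d\<close> with a double root at \<open>g\<close> and leading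
  coefficient \<open>N g + Q g > 0\<close> (lemma \<open>critical_point_minimizes_ratio\<close>).

  For the limits, numerator and denominator of the estimate are rescaled. When \<open>a \<longlonglongrightarrow> 0\<close> and
  \<open>b \<longlonglongrightarrow> \<infinity>\<close>, dividing by \<open>b\<close> gives the limit \<open>sqrt s\<close>. When \<open>a \<longlonglongrightarrow> -\<infinity>\<close> and \<open>b \<longlonglongrightarrow> \<infinity>\<close>,
  the sign of \<open>p\<close> is not controlled and \<open>p\<close> may vanish; the conjugate form
  \<open>- q / (u + sqrt (u\<^sup>2 - p q))\<close> of the root has no such singularity, and dividing by \<open>- a b\<close>
  gives the limit \<open>m\<close>. These limits minimize \<open>N d\<close> and \<open>N d / d\<close> by completing the square.
\<close>

section \<open>The critical point of the interval squared risk\<close>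

text \<open>
  With \<open>\<Delta> = u\<^sup>2 - p * q\<close> one has \<open>\<Delta> = (p * x + u)\<^sup>2 - p * P x\<close> for every \<open>x\<close>, where \<open>P\<close> is the
  quadratic. The signs of \<open>P\<close> at the endpoints therefore place \<open>sqrt \<Delta>\<close> between
  \<open>\<bar>p * a + u\<bar>\<close> and \<open>\<bar>p * b + u\<bar>\<close>. The \<open>+\<close> sign is the right one because the slope of
  \<open>P\<close> at the root is \<open>2 * sqrt \<Delta> \<ge> 0\<close>.
\<close>

lemma increasing_quadratic_root_between:
  fixes p u q a b :: real
  defines "r \<equiv> (- u + sqrt (u\<^sup>2 - p * q)) / p"
  assumes "p \<noteq> 0" "a < b"
    and neg: "p * a\<^sup>2 + 2 * u * a + q < 0"
    and pos: "p * b\<^sup>2 + 2 * u * b + q > 0"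
  shows "a < r" "r < b" "p * r\<^sup>2 + 2 * u * r + q = 0"
proof -
  define \<Delta> where "\<Delta> = u\<^sup>2 - p * q"
  have \<Delta>: "\<Delta> = (p * x + u)\<^sup>2 - p * (p * x\<^sup>2 + 2 * u * x + q)" for x
    by (simp add: \<Delta>_def power2_eq_square algebra_simps)
  have pr: "p * r = - u + sqrt \<Delta>"
    using \<open>p \<noteq> 0\<close> by (simp add: r_def \<Delta>_def)
  have *: "\<Delta> \<ge> 0 \<and> a < r \<and> r < b"
  proof (cases "p > 0")
    case True
    have lo: "(p * a + u)\<^sup>2 < \<Delta>"
      using \<Delta>[of a] mult_pos_neg[OF True neg] by linarith
    have hi: "\<Delta> < (p * b + u)\<^sup>2"
      using \<Delta>[of b] mult_pos_pos[OF True pos] by linarith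
    have l: "\<bar>p * a + u\<bar> < sqrt \<Delta>"
      using real_sqrt_less_mono[OF lo] by simp
    have h: "sqrt \<Delta> < \<bar>p * b + u\<bar>"
      using real_sqrt_less_mono[OF hi] by simp
    have "p * a < p * b" using True \<open>a < b\<close> by simp
    with l h pr have "p * a < p * r" "p * r < p * b" by linarith+
    with True have "a < r" "r < b" by simp_all
    with lo show ?thesis by (smt (verit) zero_le_power2)
  next
    case False
    with \<open>p \<noteq> 0\<close> have False': "p < 0" by simp
    have lo: "(p * b + u)\<^sup>2 < \<Delta>"
      using \<Delta>[of b] mult_neg_pos[OF False' pos] by linarith
    have hi: "\<Delta> < (p * a + u)\<^sup>2"
      using \<Delta>[of a] mult_neg_neg[OF False' neg] by linarith
    have l: "\<bar>p * b + u\<bar> < sqrt \<Delta>"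
      using real_sqrt_less_mono[OF lo] by simp
    have h: "sqrt \<Delta> < \<bar>p * a + u\<bar>"
      using real_sqrt_less_mono[OF hi] by simp
    have "p * b < p * a" using False' \<open>a < b\<close> by simp
    with l h pr have "p * b < p * r" "p * r < p * a" by linarith+
    with False' have "a < r" "r < b" by simp_all
    with lo show ?thesis by (smt (verit) zero_le_power2)
  qed
  then show "a < r" "r < b" by simp_all
  from * have "(p * r + u)\<^sup>2 = \<Delta>" by (simp add: pr)
  with \<Delta>[of r] \<open>p \<noteq> 0\<close> show "p * r\<^sup>2 + 2 * u * r + q = 0" by simp
qed

text \<open>
  At the endpoints \<open>Q\<close> vanishes, so the derivative numerator \<open>N' Q - N Q'\<close> reduces to
  \<open>- (b - a) * N a < 0\<close> and \<open>(b - a) * N b > 0\<close>. In the degenerate case \<open>a + b = 2 * m\<close> it is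
  linear with root \<open>m\<close>.
\<close>

lemma iq_estimate_critical:
  fixes a b m s :: real
  assumes "a < m" "m < b" "m\<^sup>2 \<le> s"
  defines "g \<equiv> iq_estimate a b m s"
  shows "a < g" "g < b"
    and "(a + b - 2 * m) * g\<^sup>2 + 2 * (s - a * b) * g + (2 * a * b * m - (a + b) * s) = 0"
proof -
  let ?p = "a + b - 2 * m" and ?u = "s - a * b" and ?q = "2 * a * b * m - (a + b) * s"
  have "a < g \<and> g < b \<and> ?p * g\<^sup>2 + 2 * ?u * g + ?q = 0"
  proof (cases "a + b = 2 * m")
    case True
    then have "g = m" by (simp add: g_def iq_estimate_def)
    with True assms show ?thesis by (simp add: algebra_simps)
  next
    case False
    have g: "g = (- ?u + sqrt (?u\<^sup>2 - ?p * ?q)) / ?p"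
      using False by (simp add: g_def iq_estimate_def)
    have N_pos: "0 < (x - m)\<^sup>2 + (s - m\<^sup>2)" if "x \<noteq> m" for x
      using that assms by (intro add_pos_nonneg) auto
    have "?p * a\<^sup>2 + 2 * ?u * a + ?q = - ((b - a) * ((a - m)\<^sup>2 + (s - m\<^sup>2)))"
      by (simp add: power2_eq_square algebra_simps)
    also have "\<dots> < 0" using N_pos[of a] assms by simp
    finally have neg: "?p * a\<^sup>2 + 2 * ?u * a + ?q < 0" .
    have "0 < (b - a) * ((b - m)\<^sup>2 + (s - m\<^sup>2))" using N_pos[of b] assms by simp
    also have "\<dots> = ?p * b\<^sup>2 + 2 * ?u * b + ?q"
      by (simp add: power2_eq_square algebra_simps)
    finally have pos: "0 < ?p * b\<^sup>2 + 2 * ?u * b + ?q" .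
    have "?p \<noteq> 0" "a < b" using False assms by simp_all
    from increasing_quadratic_root_between[OF this neg pos]
    show ?thesis unfolding g by blast
  qed
  then show "a < g" "g < b" "?p * g\<^sup>2 + 2 * ?u * g + ?q = 0" by simp_all
qed

text \<open>
  Taylor expansion at \<open>g\<close> is exact for the quadratic \<open>N d * Q g - N g * Q d\<close>: its value at \<open>g\<close>
  is zero, its slope there is the derivative numerator, and its leading coefficient is
  \<open>Q g + N g\<close>.
\<close>

lemma critical_point_minimizes_ratio:
  fixes a b m s g d :: real
  assumes g: "a < g" "g < b" and d: "a < d" "d < b" and "m\<^sup>2 \<le> s"
    and crit: "(a + b - 2 * m) * g\<^sup>2 + 2 * (s - a * b) * g + (2 * a * b * m - (a + b) * s) = 0"
  shows "(g\<^sup>2 - 2 * g * m + s) / ((g - a) * (b - g)) \<le> (d\<^sup>2 - 2 * d * m + s) / ((d - a) * (b - d))"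
proof -
  define N Q where "N x = x\<^sup>2 - 2 * x * m + s" and "Q x = (x - a) * (b - x)" for x
  have Q_pos: "0 < Q g" "0 < Q d" using g d by (simp_all add: Q_def)
  have "N g = (g - m)\<^sup>2 + (s - m\<^sup>2)" by (simp add: N_def power2_eq_square algebra_simps)
  also have "\<dots> \<ge> 0" using \<open>m\<^sup>2 \<le> s\<close> by simp
  finally have "0 \<le> N g" .
  have "N d * Q g - N g * Q d = (Q g + N g) * (d - g)\<^sup>2
      + ((a + b - 2 * m) * g\<^sup>2 + 2 * (s - a * b) * g + (2 * a * b * m - (a + b) * s)) * (d - g)"
    by (simp add: N_def Q_def power2_eq_square algebra_simps)
  also have "\<dots> = (Q g + N g) * (d - g)\<^sup>2" unfolding crit by simp
  also have "\<dots> \<ge> 0" using Q_pos \<open>0 \<le> N g\<close> by simp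
  finally have "N g / Q g \<le> N d / Q d" using Q_pos by (simp add: field_simps)
  then show ?thesis by (simp add: N_def Q_def)
qed

section \<open>Limits of the estimate\<close>

text \<open>
  Multiplying numerator and denominator by the conjugate cancels the factor \<open>a + b - 2 * m\<close>. The
  result covers both cases of the definition, because at \<open>a + b = 2 * m\<close> it evaluates to \<open>m\<close>.
\<close>

lemma iq_estimate_conjugate:
  fixes a b m s :: real
  defines "\<Delta> \<equiv> (s - a * b)\<^sup>2 - (a + b - 2 * m) * (2 * a * b * m - (a + b) * s)"
  assumes "0 < s - a * b" "0 \<le> \<Delta>"
  shows "iq_estimate a b m s = ((a + b) * s - 2 * a * b * m) / (s - a * b + sqrt \<Delta>)"
proof -
  have den: "0 < s - a * b + sqrt \<Delta>" using assms(2,3) by (simp add: add_pos_nonneg)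
  show ?thesis
  proof (cases "a + b = 2 * m")
    case True
    then have "sqrt \<Delta> = s - a * b" using assms(2) by (simp add: \<Delta>_def)
    moreover have "(a + b) * s - 2 * a * b * m = m * (2 * (s - a * b))"
      by (simp add: True algebra_simps)
    ultimately show ?thesis using True assms(2) by (simp add: iq_estimate_def)
  next
    case False
    have "(a * b - s + sqrt \<Delta>) * (s - a * b + sqrt \<Delta>) = (sqrt \<Delta>)\<^sup>2 - (s - a * b)\<^sup>2"
      by (simp add: power2_eq_square algebra_simps)
    also have "\<dots> = ((a + b) * s - 2 * a * b * m) * (a + b - 2 * m)"
      using assms(3) by (simp add: \<Delta>_def algebra_simps)
    finally show ?thesis
      using False den by (simp add: iq_estimate_def \<Delta>_def[symmetric] frac_eq_eq)
  qed
qed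

lemma tendsto_iq_estimate_unbounded:
  fixes a b :: "'c \<Rightarrow> real" and m s :: real
  assumes a: "filterlim a at_bot F" and b: "filterlim b at_top F"
  shows "((\<lambda>x. iq_estimate (a x) (b x) m s) \<longlongrightarrow> m) F"
proof -
  define i j where "i x = inverse (a x)" and "j x = inverse (b x)" for x
  have i: "(i \<longlongrightarrow> 0) F" and j: "(j \<longlongrightarrow> 0) F"
    unfolding i_def j_def
    using a b by (auto intro: tendsto_inverse_0[THEN filterlim_compose] filterlim_mono
        at_bot_le_at_infinity at_top_le_at_infinity)
  \<comment> \<open>The quantities \<open>u\<close>, \<open>p\<close>, \<open>q\<close> divided by \<open>- a * b > 0\<close>, in terms of \<open>1 / a\<close> and \<open>1 / b\<close>.\<close>
  define U P R where "U x = 1 - s * i x * j x"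
    and "P x = 2 * m * i x * j x - i x - j x"
    and "R x = (i x + j x) * s - 2 * m" for x
  have U: "(U \<longlongrightarrow> 1 - s * 0 * 0) F" and P: "(P \<longlongrightarrow> 2 * m * 0 * 0 - 0 - 0) F"
    and R: "(R \<longlongrightarrow> (0 + 0) * s - 2 * m) F"
    unfolding U_def P_def R_def by (intro tendsto_intros i j)+
  have D: "((\<lambda>x. (U x)\<^sup>2 - P x * R x) \<longlongrightarrow> 1) F"
    using tendsto_diff[OF tendsto_power[OF U, of 2] tendsto_mult[OF P R]] by simp
  have "((\<lambda>x. - R x / (U x + sqrt ((U x)\<^sup>2 - P x * R x)))
      \<longlongrightarrow> - (- 2 * m) / (1 + sqrt 1)) F"
    using U R by (intro tendsto_intros D) simp_all
  then have lim: "((\<lambda>x. - R x / (U x + sqrt ((U x)\<^sup>2 - P x * R x))) \<longlongrightarrow> m) F"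
    by simp
  have "eventually (\<lambda>x. a x < 0) F" "eventually (\<lambda>x. 0 < b x) F"
    using a b by (auto simp: filterlim_at_bot_dense filterlim_at_top_dense)
  moreover have "eventually (\<lambda>x. 0 < U x) F" "eventually (\<lambda>x. 0 < (U x)\<^sup>2 - P x * R x) F"
    using U D by (auto dest: order_tendstoD(1)[where a = 0])
  ultimately have "eventually (\<lambda>x. iq_estimate (a x) (b x) m s
      = - R x / (U x + sqrt ((U x)\<^sup>2 - P x * R x))) F"
  proof eventually_elim
    case (elim x)
    define c where "c = - (a x * b x)"
    have c: "0 < c" using elim by (simp add: c_def mult_neg_pos)
    have u: "s - a x * b x = c * U x" and p: "a x + b x - 2 * m = c * P x"
      and q: "2 * a x * b x * m - (a x + b x) * s = c * R x"
      using elim by (simp_all add: c_def U_def P_def R_def i_def j_def field_simps)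
    have \<Delta>: "(s - a x * b x)\<^sup>2 - (a x + b x - 2 * m) * (2 * a x * b x * m - (a x + b x) * s)
        = c\<^sup>2 * ((U x)\<^sup>2 - P x * R x)"
      unfolding u p q by (simp add: power2_eq_square algebra_simps)
    have q': "(a x + b x) * s - 2 * a x * b x * m = c * (- R x)"
      using q by simp
    have "iq_estimate (a x) (b x) m s
        = c * (- R x) / (c * U x + sqrt (c\<^sup>2 * ((U x)\<^sup>2 - P x * R x)))"
      using iq_estimate_conjugate[of s "a x" "b x" m, unfolded \<Delta>, unfolded u q'] c elim
      by simp
    also have "\<dots> = c * (- R x) / (c * (U x + sqrt ((U x)\<^sup>2 - P x * R x)))"
      using c by (simp add: real_sqrt_mult distrib_left)
    also have "\<dots> = - R x / (U x + sqrt ((U x)\<^sup>2 - P x * R x))"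
      using c by (intro nonzero_mult_divide_mult_cancel_left) simp
    finally show ?case .
  qed
  with lim show ?thesis by (simp add: tendsto_cong)
qed

text \<open>
  Dividing by \<open>b\<close> suffices whatever the sign of \<open>a\<close> and the size of \<open>a * b\<close>, since the latter is
  still negligible against \<open>b\<close>.
\<close>

lemma tendsto_iq_estimate_half_line:
  fixes a b :: "'c \<Rightarrow> real" and m s :: real
  assumes a: "(a \<longlongrightarrow> 0) F" and b: "filterlim b at_top F"
  shows "((\<lambda>x. iq_estimate (a x) (b x) m s) \<longlongrightarrow> sqrt s) F"
proof -
  define j where "j x = inverse (b x)" for x
  have j: "(j \<longlongrightarrow> 0) F"
    unfolding j_def using b by (auto intro: tendsto_inverse_0[THEN filterlim_compose] filterlim_mono
        at_top_le_at_infinity)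
  \<comment> \<open>The quantities \<open>u\<close>, \<open>p\<close>, \<open>q\<close> divided by \<open>b\<close>.\<close>
  define U P R where "U x = s * j x - a x"
    and "P x = 1 + (a x - 2 * m) * j x"
    and "R x = 2 * a x * m - (a x * j x + 1) * s" for x
  have U: "(U \<longlongrightarrow> s * 0 - 0) F" and P: "(P \<longlongrightarrow> 1 + (0 - 2 * m) * 0) F"
    and R: "(R \<longlongrightarrow> 2 * 0 * m - (0 * 0 + 1) * s) F"
    unfolding U_def P_def R_def by (intro tendsto_intros a j)+
  have D: "((\<lambda>x. (U x)\<^sup>2 - P x * R x) \<longlongrightarrow> s) F"
    using tendsto_diff[OF tendsto_power[OF U, of 2] tendsto_mult[OF P R]] by simp
  have "((\<lambda>x. (- U x + sqrt ((U x)\<^sup>2 - P x * R x)) / P x) \<longlongrightarrow> (- 0 + sqrt s) / 1) F"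
    using U P by (intro tendsto_intros D) simp_all
  then have lim: "((\<lambda>x. (- U x + sqrt ((U x)\<^sup>2 - P x * R x)) / P x) \<longlongrightarrow> sqrt s) F"
    by simp
  have "eventually (\<lambda>x. 0 < b x) F"
    using b by (auto simp: filterlim_at_top_dense)
  moreover have "eventually (\<lambda>x. 0 < P x) F"
    using P by (auto dest: order_tendstoD(1)[where a = 0])
  ultimately have "eventually (\<lambda>x. iq_estimate (a x) (b x) m s
      = (- U x + sqrt ((U x)\<^sup>2 - P x * R x)) / P x) F"
  proof eventually_elim
    case (elim x)
    let ?b = "b x"
    have u: "s - a x * ?b = ?b * U x" and p: "a x + ?b - 2 * m = ?b * P x"
      and q: "2 * a x * ?b * m - (a x + ?b) * s = ?b * R x"
      using elim by (simp_all add: U_def P_def R_def j_def field_simps)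
    have \<Delta>: "(s - a x * ?b)\<^sup>2 - (a x + ?b - 2 * m) * (2 * a x * ?b * m - (a x + ?b) * s)
        = ?b\<^sup>2 * ((U x)\<^sup>2 - P x * R x)"
      unfolding u p q by (simp add: power2_eq_square algebra_simps)
    have u': "a x * ?b - s = ?b * (- U x)" using u by simp
    have "0 < ?b * P x" using elim by simp
    then have "a x + ?b \<noteq> 2 * m" using p by linarith
    then have "iq_estimate (a x) ?b m s
        = (?b * (- U x) + sqrt (?b\<^sup>2 * ((U x)\<^sup>2 - P x * R x))) / (?b * P x)"
      unfolding iq_estimate_def \<Delta> unfolding u' p by simp
    also have "\<dots> = ?b * (- U x + sqrt ((U x)\<^sup>2 - P x * R x)) / (?b * P x)"
      using elim by (simp only: real_sqrt_mult distrib_left) simp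
    also have "\<dots> = (- U x + sqrt ((U x)\<^sup>2 - P x * R x)) / P x"
      using elim by (intro nonzero_mult_divide_mult_cancel_left) simp
    finally show ?case .
  qed
  with lim show ?thesis by (simp add: tendsto_cong)
qed

section \<open>Minimal expected losses\<close>

lemma (in prob_space) expectation_square_diff:
  fixes X :: "'a \<Rightarrow> real"
  assumes "integrable M X" "integrable M (\<lambda>\<omega>. (X \<omega>)\<^sup>2)"
  shows "expectation (\<lambda>\<omega>. (d - X \<omega>)\<^sup>2) = d\<^sup>2 - 2 * d * expectation X + expectation (\<lambda>\<omega>. (X \<omega>)\<^sup>2)"
proof -
  have "expectation (\<lambda>\<omega>. (d - X \<omega>)\<^sup>2) = expectation (\<lambda>\<omega>. d\<^sup>2 - 2 * d * X \<omega> + (X \<omega>)\<^sup>2)"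
    by (simp add: power2_diff algebra_simps)
  also have "\<dots> = d\<^sup>2 - 2 * d * expectation X + expectation (\<lambda>\<omega>. (X \<omega>)\<^sup>2)"
    using assms by (simp add: prob_space)
  finally show ?thesis .
qed

lemma minimizes_expected_lossI:
  assumes "g \<in> D" "\<And>d. d \<in> D \<Longrightarrow> expected_loss M \<theta> L g \<le> expected_loss M \<theta> L d"
  shows "minimizes_expected_loss M \<theta> L D g"
  using assms by (force simp: minimizes_expected_loss_def is_arg_min_def not_less)

theorem theorem2:
  fixes M :: "'a measure" and \<theta> :: "'a \<Rightarrow> real" and f :: "real \<Rightarrow> real"
  assumes "prob_space M"
    and "\<And>x. 0 \<le> f x"
    and "distributed M lborel \<theta> (\<lambda>x. ennreal (f x))"
    and "integrable M (\<lambda>\<omega>. (\<theta> \<omega>)\<^sup>2)"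
  shows
    "(\<forall>a b. a < b \<longrightarrow> (AE \<omega> in M. \<theta> \<omega> \<in> {a<..<b}) \<longrightarrow>
        minimizes_expected_loss M \<theta> (interval_squared_loss a b) {a<..<b}
          (iq_estimate a b (\<integral>\<omega>. \<theta> \<omega> \<partial>M) (\<integral>\<omega>. (\<theta> \<omega>)\<^sup>2 \<partial>M)))
     \<and> (\<exists>l. ((\<lambda>(a, b). iq_estimate a b (\<integral>\<omega>. \<theta> \<omega> \<partial>M) (\<integral>\<omega>. (\<theta> \<omega>)\<^sup>2 \<partial>M)) \<longlongrightarrow> l)
              (at_bot \<times>\<^sub>F at_top)
            \<and> minimizes_expected_loss M \<theta> squared_loss UNIV l)
     \<and> ((AE \<omega> in M. 0 < \<theta> \<omega>) \<longrightarrow>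
        (\<exists>l. ((\<lambda>(a, b). iq_estimate a b (\<integral>\<omega>. \<theta> \<omega> \<partial>M) (\<integral>\<omega>. (\<theta> \<omega>)\<^sup>2 \<partial>M)) \<longlongrightarrow> l)
               (at 0 \<times>\<^sub>F at_top)
             \<and> minimizes_expected_loss M \<theta> precautionary_loss {0<..} l))"
proof -
  interpret prob_space M by fact
  have "\<theta> \<in> borel_measurable M"
    using distributed_measurable[OF assms(3)] by simp
  then have int: "integrable M \<theta>"
    using assms(4) by (rule square_integrable_imp_integrable)
  define m s where "m = expectation \<theta>" and "s = expectation (\<lambda>\<omega>. (\<theta> \<omega>)\<^sup>2)"
  have risk: "expectation (\<lambda>\<omega>. (d - \<theta> \<omega>)\<^sup>2) = d\<^sup>2 - 2 * d * m + s" for d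
    unfolding m_def s_def by (rule expectation_square_diff[OF int assms(4)])
  have "0 \<le> expectation (\<lambda>\<omega>. (m - \<theta> \<omega>)\<^sup>2)" by simp
  then have ms: "m\<^sup>2 \<le> s" unfolding risk by (simp add: power2_eq_square)

  have interval: "minimizes_expected_loss M \<theta> (interval_squared_loss a b) {a<..<b}
      (iq_estimate a b m s)" if "AE \<omega> in M. \<theta> \<omega> \<in> {a<..<b}" for a b
  proof -
    have "a < m" "m < b"
      unfolding m_def using that
      by (auto intro!: expectation_less[OF int] expectation_greater[OF int])
    note g = iq_estimate_critical[OF this ms]
    have "expected_loss M \<theta> (interval_squared_loss a b) d
        = (d\<^sup>2 - 2 * d * m + s) / ((d - a) * (b - d))" for d
      by (simp add: expected_loss_def interval_squared_loss_def risk)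
    then show ?thesis
      using g critical_point_minimizes_ratio[OF g(1,2) _ _ ms g(3)]
      by (intro minimizes_expected_lossI) auto
  qed

  have squared: "minimizes_expected_loss M \<theta> squared_loss UNIV m"
  proof (rule minimizes_expected_lossI)
    fix d
    have "expected_loss M \<theta> squared_loss d = (d - m)\<^sup>2 + (s - m\<^sup>2)" for d
      using risk[of d]
      by (simp add: expected_loss_def squared_loss_def power2_commute power2_diff algebra_simps)
    then show "expected_loss M \<theta> squared_loss m \<le> expected_loss M \<theta> squared_loss d" by simp
  qed simp

  have precautionary: "minimizes_expected_loss M \<theta> precautionary_loss {0<..} (sqrt s)"
    if "AE \<omega> in M. 0 < \<theta> \<omega>"
  proof -
    have "0 < m" unfolding m_def using that by (rule expectation_greater[OF int])
    then have s: "0 < s" using ms by (smt (verit) zero_less_power2)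
    have loss: "expected_loss M \<theta> precautionary_loss d = (d - sqrt s)\<^sup>2 / d + 2 * (sqrt s - m)"
      if "0 < d" for d
    proof -
      have "d\<^sup>2 - 2 * d * m + s = (d - sqrt s)\<^sup>2 + 2 * (sqrt s - m) * d"
        using s by (simp add: power2_diff algebra_simps)
      then show ?thesis
        using that
        by (simp add: expected_loss_def precautionary_loss_def risk add_divide_distrib)
    qed
    show ?thesis
      by (rule minimizes_expected_lossI) (use s in \<open>auto simp: loss\<close>)
  qed

  have "((\<lambda>(a, b). iq_estimate a b m s) \<longlongrightarrow> m) (at_bot \<times>\<^sub>F at_top)"
    unfolding case_prod_beta
    by (intro tendsto_iq_estimate_unbounded filterlim_fst filterlim_snd)
  moreover have "((\<lambda>(a, b). iq_estimate a b m s) \<longlongrightarrow> sqrt s) (at 0 \<times>\<^sub>F at_top)"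
    unfolding case_prod_beta
    by (intro tendsto_iq_estimate_half_line filterlim_snd
        filterlim_mono[OF filterlim_fst at_within_le_nhds order_refl])
  ultimately show ?thesis
    using interval squared precautionary unfolding m_def s_def by blast
qed

end
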